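(* Let $k\ge1$ and $m\ge0$ be integers. Then, as formal power series in $q$, $$\sum_{n=0}^{m} \frac{q^{k\cdot 1+k\cdot 2+\cdots+k\cdot n}}{(1-q)(1-q^2)\cdots(1-q^n)} \prod_{j=n+1}^{\infty}\left(1+q^j+q^{2j}+\cdots+q^{(k-1)j}\right) = \prod_{j=1}^{\infty}\frac{1-q^{jk}}{1-q^j}\cdot\sum_{n=0}^{m}\frac{q^{kn(n+1)/2}}{(1-q^k)(1-q^{2k})\cdots(1-q^{nk})}.$$
   Context: Empty products equal $1$ and empty sums in exponents equal $0$ (the case $n=0$). *)

theory Defs
  imports "HOL-Computational_Algebra.Formal_Power_Series" "HOL-Analysis.Infinite_Products"
begin

text \<open>
  Infinite products of formal power series are \<^const>\<open>prodinf\<close> with respect to the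
  coefficientwise (\<open>X\<close>-adic) topology. Since \<^const>\<open>prodinf\<close> is unspecified for
  divergent products, we record that the products used below converge.
\<close>

lemma convergent_prod_fpsI:
  fixes f :: "nat \<Rightarrow> 'a :: field fps"
  assumes "\<And>j. \<exists>g. f j = 1 + fps_X ^ Suc j * g"
  shows   "convergent_prod f"
proof -
  obtain g where g: "\<And>j. f j = 1 + fps_X ^ Suc j * g j"
    using assms by metis
  define P where "P = (\<lambda>n. \<Prod>i\<le>n. f i)"
  define L where "L = Abs_fps (\<lambda>n. fps_nth (P n) n)"
  have step: "fps_nth (P (Suc N)) n = fps_nth (P N) n" if "n \<le> N" for n N
  proof -
    have "P (Suc N) = P N + fps_X ^ Suc (Suc N) * (P N * g (Suc N))"
      by (simp add: P_def g algebra_simps del: power_Suc)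
    thus ?thesis
      using that by (simp add: fps_X_power_mult_nth del: power_Suc)
  qed
  have stable: "fps_nth (P N) n = fps_nth L n" if "n \<le> N" for n N
    using that by (induction N rule: dec_induct) (simp_all add: L_def step)
  have "P \<longlonglongrightarrow> L"
    by (rule tendsto_fpsI) (use stable in \<open>auto intro: eventually_sequentiallyI\<close>)
  moreover have "fps_nth (P n) 0 = 1" for n
    by (induction n) (simp_all add: P_def g)
  hence "fps_nth L 0 = 1"
    by (simp add: L_def)
  hence "L \<noteq> 0"
    by auto
  ultimately have "f has_prod L"
    by (simp add: has_prod_def raw_has_prod_def P_def)
  thus "convergent_prod f"
    by (auto simp: has_prod_def convergent_prod_def)
qed

lemma convergent_prod_geometric_fps:
  fixes k n :: nat
  assumes "k \<ge> 1"
  shows "convergent_prod (\<lambda>j. \<Sum>i<k. (fps_X :: 'a :: field fps) ^ (i * (n + 1 + j)))"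
proof (rule convergent_prod_fpsI)
  fix j
  obtain k' where k: "k = Suc k'"
    using assms by (cases k) auto
  have "(\<Sum>i<k. (fps_X :: 'a fps) ^ (i * (n + 1 + j))) =
          1 + (\<Sum>i<k'. fps_X ^ (Suc i * (n + 1 + j)))"
    unfolding k by (subst sum.lessThan_Suc_shift) simp
  also have "(\<Sum>i<k'. (fps_X :: 'a fps) ^ (Suc i * (n + 1 + j))) =
               fps_X ^ Suc j * (\<Sum>i<k'. fps_X ^ (n + i * (n + 1 + j)))"
    unfolding sum_distrib_left power_add [symmetric] by (simp add: algebra_simps)
  finally show "\<exists>g. (\<Sum>i<k. (fps_X :: 'a fps) ^ (i * (n + 1 + j))) = 1 + fps_X ^ Suc j * g"
    by blast
qed

lemma convergent_prod_quotient_fps: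
  fixes k :: nat
  assumes "k \<ge> 1"
  shows "convergent_prod (\<lambda>j. (1 - fps_X ^ ((j + 1) * k)) / (1 - (fps_X :: 'a :: field fps) ^ (j + 1)))"
proof -
  have "(1 - fps_X ^ ((j + 1) * k)) / (1 - fps_X ^ (j + 1)) = 
          (\<Sum>i<k. (fps_X :: 'a fps) ^ (i * (0 + 1 + j)))" for j
  proof -
    have "(1 - fps_X ^ (j + 1)) * (\<Sum>i<k. ((fps_X :: 'a fps) ^ (j + 1)) ^ i) = 1 - (fps_X ^ (j + 1)) ^ k"
      by (rule one_diff_power_eq [symmetric])
    moreover have "fps_nth (1 - (fps_X :: 'a fps) ^ (j + 1)) 0 \<noteq> fps_nth 0 0"
      by simp
    hence "1 - (fps_X :: 'a fps) ^ (j + 1) \<noteq> 0"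
      by metis
    ultimately show ?thesis
      by (metis (no_types, lifting) nonzero_mult_div_cancel_left power_mult mult.commute
            add.commute add_0 sum.cong)
  qed
  thus ?thesis
    using convergent_prod_geometric_fps [OF assms, of 0, where ?'a = 'a] by simp
qed

end

theory Submission
  imports Defs
begin

text \<open>
  The identity holds term by term. Since \<open>1 + q\<^sup>j + \<dots> + q\<^bsup>(k-1)j\<^esup> = (1 - q\<^bsup>jk\<^esup>) / (1 - q\<^sup>j)\<close>,
  the infinite product over \<open>j > n\<close> is the full product with the factors \<open>j \<le> n\<close> split off,
  and these cancel the denominator \<open>(1 - q) \<cdots> (1 - q\<^sup>n)\<close>, leaving \<open>(1 - q\<^sup>k) \<cdots> (1 - q\<^bsup>nk\<^esup>)\<close>.
\<close>

text \<open>Coefficient \<open>n\<close> of a product involves only the coefficients of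
  \<open>f x\<close> up to \<open>n\<close>, and these finitely many are eventually equal to those
  of \<open>L\<close>.\<close>

lemma tendsto_mult_left_fps:
  fixes c :: "'a :: comm_ring_1 fps"
  assumes "(f \<longlongrightarrow> L) F"
  shows   "((\<lambda>x. c * f x) \<longlongrightarrow> c * L) F"
proof (rule tendsto_fpsI)
  fix n
  have "\<forall>\<^sub>F x in F. \<forall>i\<in>{..n}. fps_nth (f x) i = fps_nth L i"
    using assms by (intro eventually_ball_finite) (simp_all add: tendsto_fps_iff)
  thus "\<forall>\<^sub>F x in F. fps_nth (c * f x) n = fps_nth (c * L) n"
    by eventually_elim (simp add: fps_mult_nth)
qed

text \<open>The first \<open>M\<close> factors are put back in front of the limit of the tail. In an
  integral domain the new limit stays nonzero, so the product may be started at index 0.\<close>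

lemma raw_has_prod_imp_has_prod_fps:
  fixes f :: "nat \<Rightarrow> 'a :: idom fps"
  assumes nz: "\<And>i. f i \<noteq> 0" and p: "raw_has_prod f M p"
  shows   "f has_prod ((\<Prod>i<M. f i) * p)"
proof -
  have split: "(\<Prod>i\<le>n + M. f i) = (\<Prod>i<M. f i) * (\<Prod>i\<le>n. f (i + M))" for n
  proof -
    have "(\<Prod>i<l + M. f i) = (\<Prod>i<M. f i) * (\<Prod>i<l. f (i + M))" for l
      by (induction l) (simp_all add: mult_ac)
    from this [of "Suc n"] show ?thesis
      by (simp only: add_Suc lessThan_Suc_atMost)
  qed
  have "(\<lambda>n. (\<Prod>i<M. f i) * (\<Prod>i\<le>n. f (i + M))) \<longlonglongrightarrow> (\<Prod>i<M. f i) * p"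
    using p by (intro tendsto_mult_left_fps) (simp add: raw_has_prod_def)
  hence "(\<lambda>n. \<Prod>i\<le>n. f i) \<longlonglongrightarrow> (\<Prod>i<M. f i) * p"
    unfolding split [symmetric] by (rule LIMSEQ_offset)
  moreover have "(\<Prod>i<M. f i) * p \<noteq> 0"
    using nz p by (auto simp: raw_has_prod_def)
  ultimately show ?thesis
    by (simp add: has_prod_def raw_has_prod_def)
qed

lemma convergent_prod_has_prod_fps:
  fixes f :: "nat \<Rightarrow> 'a :: idom fps"
  assumes "\<And>i. f i \<noteq> 0" and "convergent_prod f"
  shows   "f has_prod prodinf f"
proof -
  obtain M p where "raw_has_prod f M p"
    using assms(2) by (auto simp: convergent_prod_def)
  hence "f has_prod ((\<Prod>i<M. f i) * p)"
    by (intro raw_has_prod_imp_has_prod_fps assms(1))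
  thus ?thesis
    using has_prod_unique by metis
qed

lemma prodinf_split_initial_segment_fps:
  fixes f :: "nat \<Rightarrow> 'a :: idom fps"
  assumes nz: "\<And>i. f i \<noteq> 0" and conv: "convergent_prod (\<lambda>j. f (j + n))"
  shows   "prodinf f = (\<Prod>i<n. f i) * (\<Prod>j. f (j + n))"
proof -
  have "(\<lambda>j. f (j + n)) has_prod (\<Prod>j. f (j + n))"
    using nz conv by (rule convergent_prod_has_prod_fps)
  \<comment> \<open>The other case of \<open>has_prod\<close>, a vanishing factor with value 0, is
    excluded by \<open>nz\<close>. What remains is literally the statement about \<open>f\<close>
    started at index \<open>n\<close>.\<close>
  hence "raw_has_prod f n (\<Prod>j. f (j + n))"
    using nz by (simp add: has_prod_def raw_has_prod_def)
  thus ?thesis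
    using raw_has_prod_imp_has_prod_fps nz has_prod_unique by metis
qed

lemma one_minus_fps_X_power_nz:
  assumes "n > 0"
  shows   "1 - fps_X ^ n \<noteq> (0 :: 'a :: comm_ring_1 fps)"
proof
  assume "1 - fps_X ^ n = (0 :: 'a fps)"
  hence "fps_nth (1 - fps_X ^ n :: 'a fps) 0 = 0"
    by simp
  thus False
    using assms by simp
qed

lemma fps_geometric_sum:
  assumes "n > 0"
  shows   "(\<Sum>i<k. (fps_X :: 'a :: field fps) ^ (i * n)) = (1 - fps_X ^ (n * k)) / (1 - fps_X ^ n)"
proof -
  have "(1 - fps_X ^ n) * (\<Sum>i<k. (fps_X :: 'a fps) ^ (i * n)) = 1 - fps_X ^ (n * k)"
    using one_diff_power_eq [of "(fps_X :: 'a fps) ^ n" k]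
    by (simp add: power_mult [symmetric] mult.commute)
  thus ?thesis
    using one_minus_fps_X_power_nz [OF assms] by (metis nonzero_mult_div_cancel_left)
qed

lemma fps_nth_0_prod:
  fixes f :: "'i \<Rightarrow> 'a :: comm_semiring_1 fps"
  shows "fps_nth (\<Prod>i\<in>A. f i) 0 = (\<Prod>i\<in>A. fps_nth (f i) 0)"
  by (induction A rule: infinite_finite_induct) simp_all

text \<open>Nonzero constant terms make \<open>b\<close> and \<open>d\<close> units, so both
  quotients are products with inverses and cross-multiplication is valid.\<close>

lemma fps_divide_eqI:
  fixes a b c d :: "'a :: field fps"
  assumes "fps_nth b 0 \<noteq> 0" "fps_nth d 0 \<noteq> 0" "a * d = c * b"
  shows   "a / b = c / d"
proof -
  have "a / b = a * d * inverse b * inverse d"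
    using assms(1,2) inverse_mult_eq_1' [of d] by (simp add: fps_divide_unit mult_ac)
  also have "\<dots> = c / d"
    using assms inverse_mult_eq_1' [of b] by (simp add: fps_divide_unit mult_ac)
  finally show ?thesis .
qed

theorem mainTheorem3:
  fixes k m :: nat
  assumes "k \<ge> 1"
  defines "q \<equiv> (fps_X :: 'a :: field fps)"
  shows
    "(\<Sum>n=0..m. q ^ (\<Sum>i=1..n. k * i) / (\<Prod>i=1..n. 1 - q ^ i)
         * (\<Prod>j. \<Sum>i<k. q ^ (i * (n + 1 + j)))) =
     (\<Prod>j. (1 - q ^ ((j + 1) * k)) / (1 - q ^ (j + 1)))
         * (\<Sum>n=0..m. q ^ (k * n * (n + 1) div 2) / (\<Prod>i=1..n. 1 - q ^ (i * k)))"
proof -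
  define f where "f = (\<lambda>j. (1 - q ^ ((j + 1) * k)) / (1 - q ^ (j + 1)))"
  have f_geom: "f j = (\<Sum>i<k. q ^ (i * (j + 1)))" for j
    by (simp only: f_def q_def fps_geometric_sum)
  \<comment> \<open>The geometric sum telescopes. This division-free form serves both to show
    \<open>f j \<noteq> 0\<close> and to cancel the denominators.\<close>
  have f_mult: "f j * (1 - q ^ Suc j) = 1 - q ^ (Suc j * k)" for j
    using one_diff_power_eq [of "q ^ Suc j" k]
    by (simp add: f_geom power_mult [symmetric] mult.commute del: power_Suc)
  have f_nz: "f j \<noteq> 0" for j
    using f_mult [of j] one_minus_fps_X_power_nz [of "Suc j * k", where ?'a = 'a] assms(1)
    by (auto simp: q_def)
  have term_eq: "q ^ (\<Sum>i=1..n. k * i) / (\<Prod>i=1..n. 1 - q ^ i) * (\<Prod>j. \<Sum>i<k. q ^ (i * (n + 1 + j))) =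
          prodinf f * (q ^ (k * n * (n + 1) div 2) / (\<Prod>i=1..n. 1 - q ^ (i * k)))" for n
  proof -
    define T where "T = (\<Prod>j. \<Sum>i<k. q ^ (i * (n + 1 + j)))"
    define e where "e = k * n * (n + 1) div 2"
    define A where "A = (\<Prod>i=1..n. 1 - q ^ i)"
    define B where "B = (\<Prod>i=1..n. 1 - q ^ (i * k))"
    \<comment> \<open>Since \<open>f j\<close> is the factor with exponent \<open>j + 1\<close>, the
      factor with exponent \<open>n + 1 + j\<close> is \<open>f (j + n)\<close>.\<close>
    have shift: "(\<lambda>j. \<Sum>i<k. q ^ (i * (n + 1 + j))) = (\<lambda>j. f (j + n))"
      by (simp add: f_geom add_ac)
    have e: "(\<Sum>i=1..n. k * i) = e"
      unfolding e_def by (induction n) (simp_all add: algebra_simps)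
    have "convergent_prod (\<lambda>j. f (j + n))"
      using convergent_prod_geometric_fps [OF assms(1), of n, where ?'a = 'a]
      unfolding q_def [symmetric] shift .
    hence F: "prodinf f = (\<Prod>i<n. f i) * T"
      unfolding T_def shift using f_nz by (intro prodinf_split_initial_segment_fps)
    \<comment> \<open>After reindexing \<open>A\<close> and \<open>B\<close> from 0, this is
      \<open>f_mult\<close> factor by factor.\<close>
    have fin: "(\<Prod>i<n. f i) * A = B"
      unfolding A_def B_def
      by (simp add: prod.atLeast1_atMost_eq prod.distrib [symmetric] f_mult del: power_Suc mult_Suc)
    \<comment> \<open>Every factor has constant term 1; for \<open>B\<close> this uses
      \<open>k \<ge> 1\<close>, which keeps the exponents \<open>i * k\<close> positive.\<close>
    have unit: "fps_nth A 0 \<noteq> 0" "fps_nth B 0 \<noteq> 0"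
      using assms(1) by (simp_all add: A_def B_def q_def fps_nth_0_prod)
    have "q ^ e / A * T = (q ^ e * T) / A"
      using unit by (simp add: fps_divide_unit mult_ac)
    \<comment> \<open>Cross-multiplied, both sides become
      \<open>q ^ e * T * A * (\<Prod>i<n. f i)\<close> by \<open>F\<close> and
      \<open>fin\<close>.\<close>
    also have "\<dots> = (prodinf f * q ^ e) / B"
      using unit by (intro fps_divide_eqI) (simp_all add: F fin [symmetric] mult_ac)
    also have "\<dots> = prodinf f * (q ^ e / B)"
      using unit by (simp add: fps_divide_unit mult_ac)
    finally show ?thesis
      unfolding e T_def A_def B_def e_def .
  qed
  show ?thesis
    unfolding f_def [symmetric] sum_distrib_left by (intro sum.cong refl term_eq)
qed

end
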